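(* For all integers $n\ge j\ge 0$, $${n \brace j}_{Y,\lambda}=\sum_{l=j}^{n}\sum_{k=l}^{n}\lambda^{k-l}(-1)^{n-k}S_{1,\lambda}^{Y}(n,k)L(k,l){l \brace j}_{\lambda}.$$
   Context: $\lambda$ is a fixed nonzero real number. For real $x$ and $n\ge1$: $(x)_{n}=x(x-1)\cdots(x-n+1)$, $\langle x\rangle_n=x(x+1)\cdots(x+n-1)$, $(x)_{n,\lambda}=x(x-\lambda)\cdots(x-(n-1)\lambda)$, and $(x)_0=\langle x\rangle_0=(x)_{0,\lambda}=1$. The degenerate exponential is $e_{\lambda}^{x}(t)=(1+\lambda t)^{x/\lambda}=\sum_{n\ge0}(x)_{n,\lambda}\frac{t^n}{n!}$. The degenerate logarithm is, for $\mu\ne0$ and $u>0$, $\log_{\mu}(u)=\frac{1}{\mu}(u^{\mu}-1)$; in particular $\log_{-\lambda}(u)=-\frac1\lambda(u^{-\lambda}-1)$. The Lah numbers $L(n,k)$ are defined by $\langle x\rangle_n=\sum_{k=0}^nL(n,k)(x)_k$, and the degenerate Stirling numbers of the second kind ${n\brace k}_\lambda$ by $(x)_{n,\lambda}=\sum_{k=0}^n{n\brace k}_\lambda(x)_k$ (polynomial identities in $x$, $n\ge0$). $Y$ is a real random variable whose degenerate moment generating functions exist near the origin: for every nonzero real $\lambda$ there is $r=r(\lambda)>0$ with $E[e_{\lambda}^{Y}(t)]=\sum_{n\ge0}E[(Y)_{n,\lambda}]\frac{t^n}{n!}$ for $|t|<r$. All generating-function identities are power series expansions at $t=0$. Probabilistic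 degenerate Stirling numbers of the second kind: $\frac{1}{k!}\big(E[e_{\lambda}^{Y}(t)]-1\big)^k=\sum_{n\ge k}{n\brace k}_{Y,\lambda}\frac{t^n}{n!}$, $k\ge0$. Probabilistic degenerate Stirling numbers of the first kind: $\frac{1}{k!}\big(\log_{-\lambda}(E[e_{\lambda}^{Y}(t)])\big)^k=\sum_{n\ge k}(-1)^{n-k}S_{1,\lambda}^{Y}(n,k)\frac{t^n}{n!}$, $k\ge0$. *)

theory Defs
  imports "HOL-Probability.Probability"
begin

section \<open>Factorials, degenerate exponential and degenerate logarithm\<close>

text \<open>The rising factorial is the library's \<^const>\<open>pochhammer\<close>.\<close>

definition falling :: "real \<Rightarrow> nat \<Rightarrow> real" where
  "falling x n = (\<Prod>i<n. x - real i)"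

definition deg_falling :: "real \<Rightarrow> real \<Rightarrow> nat \<Rightarrow> real" where
  "deg_falling lam x n = (\<Prod>i<n. x - real i * lam)"

text \<open>Meaningful for \<open>lam \<noteq> 0\<close> and \<open>1 + lam * t > 0\<close>, in particular for all \<open>t\<close> near the origin.\<close>

definition deg_exp :: "real \<Rightarrow> real \<Rightarrow> real \<Rightarrow> real" where
  "deg_exp lam x t = (1 + lam * t) powr (x / lam)"

definition deg_log :: "real \<Rightarrow> real \<Rightarrow> real" where
  "deg_log \<mu> u = (1 / \<mu>) * (u powr \<mu> - 1)"

section \<open>Lah numbers and degenerate Stirling numbers of the second kind\<close>

text \<open>
  The coefficients of \<open>p\<close> in the basis of falling factorials of degree at most \<open>n\<close>, extended
  by \<open>0\<close> beyond \<open>n\<close>. They are unique whenever they exist, see \<open>falling_coeff_eqI\<close>.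
\<close>

definition falling_coeff :: "(real \<Rightarrow> real) \<Rightarrow> nat \<Rightarrow> nat \<Rightarrow> real" where
  "falling_coeff p n =
     (THE c. (\<forall>x. p x = (\<Sum>k\<le>n. c k * falling x k)) \<and> (\<forall>k>n. c k = 0))"

definition lah :: "nat \<Rightarrow> nat \<Rightarrow> real" where
  "lah n k = falling_coeff (\<lambda>x. pochhammer x n) n k"

definition deg_stirling2 :: "real \<Rightarrow> nat \<Rightarrow> nat \<Rightarrow> real" where
  "deg_stirling2 lam n k = falling_coeff (\<lambda>x. deg_falling lam x n) n k"

lemma falling_of_nat_eq_0: "k < i \<Longrightarrow> falling (real k) i = 0"
  by (auto simp: falling_def)

lemma falling_of_nat_self_neq_0: "falling (real k) k \<noteq> 0"
  by (auto simp: falling_def)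

lemma falling_coeffs_unique:
  assumes "\<And>x. (\<Sum>k\<le>n. c k * falling x k) = (\<Sum>k\<le>n. d k * falling x k)"
  shows "k \<le> n \<Longrightarrow> c k = d k"
proof (induction k rule: less_induct)
  case (less k)
  have split: "(\<Sum>i\<le>n. e i * falling (real k) i) =
      (\<Sum>i<k. e i * falling (real k) i) + e k * falling (real k) k" for e
  proof -
    have "(\<Sum>i\<le>n. e i * falling (real k) i) = (\<Sum>i<Suc k. e i * falling (real k) i)"
      using less.prems by (intro sum.mono_neutral_right) (auto simp: falling_of_nat_eq_0)
    thus ?thesis by simp
  qed
  have "(\<Sum>i<k. c i * falling (real k) i) = (\<Sum>i<k. d i * falling (real k) i)"
    using less by (intro sum.cong) auto
  with assms[of "real k"] show ?case
    using falling_of_nat_self_neq_0[of k] unfolding split by simp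
qed

lemma falling_coeff_eqI:
  assumes "\<And>x. p x = (\<Sum>k\<le>n. c k * falling x k)" "\<And>k. k > n \<Longrightarrow> c k = 0"
  shows "falling_coeff p n = c"
  unfolding falling_coeff_def
proof (rule the_equality)
  fix d assume d: "(\<forall>x. p x = (\<Sum>k\<le>n. d k * falling x k)) \<and> (\<forall>k>n. d k = 0)"
  show "d = c"
  proof
    fix k show "d k = c k"
    proof (cases "k \<le> n")
      case True
      show ?thesis by (rule falling_coeffs_unique[OF _ True]) (use d assms(1) in metis)
    qed (use d assms(2) in auto)
  qed
qed (use assms in auto)

lemma prod_falling_expansion:
  "\<exists>c. (\<forall>x. (\<Prod>i<n. x + a i) = (\<Sum>k\<le>n. c k * falling x k)) \<and> (\<forall>k>n. c k = 0)"
proof (induction n)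
  case 0
  show ?case by (rule exI[of _ "\<lambda>k. if k = 0 then 1 else 0"]) (auto simp: falling_def)
next
  case (Suc n)
  then obtain c where c: "\<And>x. (\<Prod>i<n. x + a i) = (\<Sum>k\<le>n. c k * falling x k)"
    and c0: "\<And>k. k > n \<Longrightarrow> c k = 0" by blast
  define d where "d k = (if k = 0 then 0 else c (k - 1)) + (real k + a n) * c k" for k
  have "(\<Prod>i<Suc n. x + a i) = (\<Sum>k\<le>Suc n. d k * falling x k)" for x
  proof -
    have "(\<Prod>i<Suc n. x + a i) = (\<Sum>k\<le>n. c k * falling x k * (x + a n))"
      by (simp add: c sum_distrib_right)
    also have "\<dots> = (\<Sum>k\<le>n. c k * falling x (Suc k)) + (\<Sum>k\<le>n. (real k + a n) * c k * falling x k)"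
      by (simp add: falling_def algebra_simps flip: sum.distrib)
    also have "(\<Sum>k\<le>n. c k * falling x (Suc k)) =
        (\<Sum>k\<le>Suc n. (if k = 0 then 0 else c (k - 1)) * falling x k)"
      by (subst sum.atMost_Suc_shift) simp
    also have "(\<Sum>k\<le>n. (real k + a n) * c k * falling x k) =
        (\<Sum>k\<le>Suc n. (real k + a n) * c k * falling x k)"
      by (simp add: c0)
    finally show ?thesis
      by (simp add: d_def algebra_simps flip: sum.distrib)
  qed
  moreover have "\<forall>k>Suc n. d k = 0" by (auto simp: d_def c0)
  ultimately show ?case by blast
qed

lemma pochhammer_eq_sum_lah: "pochhammer x n = (\<Sum>k\<le>n. lah n k * falling x k)"
proof -
  obtain c where c: "\<And>x. (\<Prod>i<n. x + real i) = (\<Sum>k\<le>n. c k * falling x k)" "\<And>k. k > n \<Longrightarrow> c k = 0"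
    using prod_falling_expansion[where n = n and a = real] by blast
  have p: "pochhammer x n = (\<Prod>i<n. x + real i)" for x :: real
    by (simp add: pochhammer_prod lessThan_atLeast0)
  have "falling_coeff (\<lambda>x. pochhammer x n) n = c"
    by (rule falling_coeff_eqI) (simp_all add: p c)
  thus ?thesis by (simp add: lah_def p c)
qed

lemma deg_falling_eq_sum_deg_stirling2:
  "deg_falling lam x n = (\<Sum>k\<le>n. deg_stirling2 lam n k * falling x k)"
proof -
  obtain c where c: "\<And>x. (\<Prod>i<n. x + - (real i * lam)) = (\<Sum>k\<le>n. c k * falling x k)"
      "\<And>k. k > n \<Longrightarrow> c k = 0"
    using prod_falling_expansion[where n = n and a = "\<lambda>i. - (real i * lam)"] by blast
  have p: "deg_falling lam x n = (\<Prod>i<n. x + - (real i * lam))" for x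
    by (simp add: deg_falling_def)
  have "falling_coeff (\<lambda>x. deg_falling lam x n) n = c"
    by (rule falling_coeff_eqI) (simp_all only: p c)
  thus ?thesis by (simp only: deg_stirling2_def p c)
qed

section \<open>Probabilistic degenerate Stirling numbers\<close>

definition deg_mgf :: "'a measure \<Rightarrow> ('a \<Rightarrow> real) \<Rightarrow> real \<Rightarrow> real \<Rightarrow> real" where
  "deg_mgf M Y lam t = (LINT \<omega>|M. deg_exp lam (Y \<omega>) t)"

text \<open>
  Integrability is stated explicitly because the Bochner integral of a non-integrable function
  is \<open>0\<close>. Since \<open>r\<close> may be shrunk, the values of \<^const>\<open>powr\<close> at non-positive bases are irrelevant.
\<close>

definition deg_mgfs_exist :: "'a measure \<Rightarrow> ('a \<Rightarrow> real) \<Rightarrow> bool" where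
  "deg_mgfs_exist M Y \<longleftrightarrow>
     (\<forall>lam. lam \<noteq> 0 \<longrightarrow>
        (\<forall>n. integrable M (\<lambda>\<omega>. deg_falling lam (Y \<omega>) n)) \<and>
        (\<exists>r>0. \<forall>t. \<bar>t\<bar> < r \<longrightarrow>
           integrable M (\<lambda>\<omega>. deg_exp lam (Y \<omega>) t) \<and>
           (\<lambda>n. (LINT \<omega>|M. deg_falling lam (Y \<omega>) n) * t ^ n / fact n) sums deg_mgf M Y lam t))"

text \<open>
  \<open>egf_coeff f n\<close> is the coefficient of \<open>t ^ n / fact n\<close> in the power series expansion of \<open>f\<close>
  at \<open>0\<close>, for \<open>f\<close> analytic there.
\<close>

definition egf_coeff :: "(real \<Rightarrow> real) \<Rightarrow> nat \<Rightarrow> real" where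
  "egf_coeff f n = fact n * fps_nth (THE F. f has_fps_expansion F) n"

lemma has_fps_expansion_unique_real:
  fixes f :: "real \<Rightarrow> real"
  assumes "f has_fps_expansion F" "f has_fps_expansion G"
  shows "F = G"
proof -
  have deriv: "fps_nth ((fps_deriv ^^ n) H) 0 = (deriv ^^ n) f 0" if "f has_fps_expansion H" for H n
  proof -
    have "(deriv ^^ n) f has_fps_expansion (fps_deriv ^^ n) H"
      using that by (induction n) (auto intro: has_fps_expansion_deriv)
    hence "eval_fps ((fps_deriv ^^ n) H) 0 = (deriv ^^ n) f 0"
      unfolding has_fps_expansion_def by (blast dest: eventually_nhds_x_imp_x)
    thus ?thesis by (simp add: eval_fps_at_0)
  qed
  have coeff: "fps_nth ((fps_deriv ^^ n) H) 0 = fact n * fps_nth H n" for H :: "real fps" and n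
    by (simp add: fps_0th_higher_deriv)
  have "fact n * fps_nth F n = (fact n * fps_nth G n :: real)" for n
    using deriv[OF assms(1), of n] deriv[OF assms(2), of n] coeff[where n = n] by simp
  thus ?thesis by (simp add: fps_eq_iff)
qed

lemma egf_coeff_eq:
  "f has_fps_expansion F \<Longrightarrow> egf_coeff f n = fact n * fps_nth F n"
  unfolding egf_coeff_def by (subst the_equality) (auto intro: has_fps_expansion_unique_real)

definition prob_deg_stirling2 ::
    "'a measure \<Rightarrow> ('a \<Rightarrow> real) \<Rightarrow> real \<Rightarrow> nat \<Rightarrow> nat \<Rightarrow> real" where
  "prob_deg_stirling2 M Y lam n k =
     egf_coeff (\<lambda>t. (1 / fact k) * (deg_mgf M Y lam t - 1) ^ k) n"

text \<open>
  The expansion of \<open>(1 / fact k) * deg_log (- lam) (deg_mgf M Y lam t) ^ k\<close> has the coefficients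
  \<open>(- 1) ^ (n - k) * prob_deg_stirling1 M Y lam n k\<close>; the sign, being its own inverse, is moved to
  the other side. For \<open>n < k\<close> both kinds of numbers vanish, as the expansions start at \<open>t ^ k\<close>.
\<close>

definition prob_deg_stirling1 ::
    "'a measure \<Rightarrow> ('a \<Rightarrow> real) \<Rightarrow> real \<Rightarrow> nat \<Rightarrow> nat \<Rightarrow> real" where
  "prob_deg_stirling1 M Y lam n k =
     (- 1) ^ (n - k) *
     egf_coeff (\<lambda>t. (1 / fact k) * deg_log (- lam) (deg_mgf M Y lam t) ^ k) n"

end

theory Submission
  imports Defs "HOL-Complex_Analysis.Complex_Analysis"
begin

text \<open>
  Let \<open>A\<close> be the degenerate moment generating function and \<open>v = deg_log (- lam) A\<close>. For every
  real \<open>x\<close> the function \<open>A powr x\<close> has two expansions: the binomial series in \<open>A - 1\<close> gives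
  \<open>\<Sum>j. falling x j * (A - 1) ^ j / fact j\<close>, while \<open>1 - lam * v = A powr (- lam)\<close> and the binomial
  series in \<open>- lam * v\<close> give \<open>\<Sum>k. lam ^ k * pochhammer (x / lam) k * v ^ k / fact k\<close>. Rewriting
  \<open>pochhammer (x / lam) k\<close> first by Lah numbers and then by degenerate Stirling numbers, and
  comparing the coefficients of \<open>t ^ n\<close> and \<open>falling x j\<close>, yields the identity.
\<close>

section \<open>Composition of real power series\<close>

text \<open>Coefficientwise embedding, through which composition of real expansions is reduced to
  \<open>has_fps_expansion_compose\<close> over the complex numbers.\<close>

definition fps_complex_of_real :: "real fps \<Rightarrow> complex fps" where
  "fps_complex_of_real F = Abs_fps (\<lambda>n. complex_of_real (fps_nth F n))"

lemma fps_nth_complex_of_real [simp]: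
  "fps_nth (fps_complex_of_real F) n = complex_of_real (fps_nth F n)"
  by (simp add: fps_complex_of_real_def)

lemma fps_complex_of_real_mult:
  "fps_complex_of_real (F * G) = fps_complex_of_real F * fps_complex_of_real G"
  by (simp add: fps_eq_iff fps_mult_nth)

lemma fps_complex_of_real_power:
  "fps_complex_of_real (F ^ n) = fps_complex_of_real F ^ n"
  by (induction n) (auto simp: fps_complex_of_real_mult, simp add: fps_eq_iff)

lemma fps_complex_of_real_compose:
  "fps_complex_of_real (F oo G) = fps_complex_of_real F oo fps_complex_of_real G"
  by (simp add: fps_eq_iff fps_compose_nth flip: fps_complex_of_real_power)

lemma fps_conv_radius_complex_of_real [simp]:
  "fps_conv_radius (fps_complex_of_real F) = fps_conv_radius F"
  by (simp add: fps_conv_radius_def conv_radius_def)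

lemma eval_fps_complex_of_real:
  assumes "norm x < fps_conv_radius F"
  shows "eval_fps (fps_complex_of_real F) (of_real x) = of_real (eval_fps F x)"
proof -
  have "(\<lambda>n. fps_nth F n * x ^ n) sums eval_fps F x"
    using assms by (intro sums_eval_fps) simp
  hence "(\<lambda>n. complex_of_real (fps_nth F n * x ^ n)) sums of_real (eval_fps F x)"
    by (rule sums_of_real)
  thus ?thesis by (simp add: eval_fps_def sums_iff)
qed

lemma eventually_norm_less_fps_conv_radius:
  fixes F :: "'a :: {banach, real_normed_div_algebra} fps"
  assumes "fps_conv_radius F > 0"
  shows "eventually (\<lambda>x :: 'a. norm x < fps_conv_radius F) (nhds 0)"
proof -
  have "eventually (\<lambda>x. x \<in> eball (0 :: 'a) (fps_conv_radius F)) (nhds 0)"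
    using assms by (intro eventually_nhds_in_open) (auto simp: zero_ereal_def)
  thus ?thesis by eventually_elim (simp add: in_eball_iff)
qed

lemma tendsto_complex_of_real_nhds_0: "filterlim complex_of_real (nhds 0) (nhds 0)"
  by (rule tendsto_eq_rhs[OF tendsto_of_real[OF filterlim_ident]]) simp

text \<open>Since \<open>f\<close> has no values off the real axis, its complex extension is the sum
  of the embedded series itself; it agrees with \<open>f\<close> at real points near 0.\<close>

lemma has_fps_expansion_complex_of_real:
  fixes f :: "real \<Rightarrow> real"
  assumes "f has_fps_expansion F"
  shows "eval_fps (fps_complex_of_real F) has_fps_expansion fps_complex_of_real F"
    and "eventually (\<lambda>x. eval_fps (fps_complex_of_real F) (of_real x) = of_real (f x)) (nhds 0)"
proof -
  have r: "fps_conv_radius F > 0" and ev: "eventually (\<lambda>x. eval_fps F x = f x) (nhds 0)"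
    using assms by (auto simp: has_fps_expansion_def)
  show "eval_fps (fps_complex_of_real F) has_fps_expansion fps_complex_of_real F"
    using r by (intro eval_fps_has_fps_expansion) simp
  show "eventually (\<lambda>x. eval_fps (fps_complex_of_real F) (of_real x) = of_real (f x)) (nhds 0)"
    using ev eventually_norm_less_fps_conv_radius[OF r]
    by eventually_elim (simp add: eval_fps_complex_of_real)
qed

text \<open>The embedding preserves the radius of convergence, and at real points the embedded
  series takes the value of \<open>F\<close>. Agreement of \<open>h\<close> with \<open>f\<close>
  along the real axis therefore suffices.\<close>

lemma has_fps_expansion_of_complex:
  assumes h: "h has_fps_expansion fps_complex_of_real F"
    and eq: "eventually (\<lambda>x. h (of_real x) = of_real (f x)) (nhds 0)"
  shows "f has_fps_expansion F"
proof -
  have r: "fps_conv_radius F > 0"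
    and ev: "eventually (\<lambda>z. eval_fps (fps_complex_of_real F) z = h z) (nhds 0)"
    using h by (auto simp: has_fps_expansion_def)
  have "eventually (\<lambda>x. eval_fps (fps_complex_of_real F) (of_real x) = h (of_real x)) (nhds 0)"
    by (rule eventually_compose_filterlim[OF ev tendsto_complex_of_real_nhds_0])
  with eq eventually_norm_less_fps_conv_radius[OF r]
  have "eventually (\<lambda>x. eval_fps F x = f x) (nhds 0)"
    by eventually_elim (simp add: eval_fps_complex_of_real)
  with r show ?thesis by (simp add: has_fps_expansion_def)
qed

lemma has_fps_expansion_imp_filterlim_nhds:
  fixes f :: "real \<Rightarrow> real"
  assumes "f has_fps_expansion F"
  shows "filterlim f (nhds (fps_nth F 0)) (nhds 0)"
proof -
  have "(f \<longlongrightarrow> f 0) (at 0)"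
    using has_fps_expansion_imp_continuous[OF assms, of UNIV] by (simp add: continuous_within)
  hence "(f \<longlongrightarrow> f 0) (nhds 0)"
    by (simp only: tendsto_at_iff_tendsto_nhds)
  thus ?thesis
    using has_fps_expansion_imp_0_eq_fps_nth_0[OF assms] by simp
qed

lemma has_fps_expansion_compose_real:
  fixes f g :: "real \<Rightarrow> real"
  assumes F: "f has_fps_expansion F" and G: "g has_fps_expansion G" "fps_nth G 0 = 0"
  shows "(\<lambda>x. f (g x)) has_fps_expansion (F oo G)"
proof (rule has_fps_expansion_of_complex)
  let ?f = "eval_fps (fps_complex_of_real F)" and ?g = "eval_fps (fps_complex_of_real G)"
  show "(?f \<circ> ?g) has_fps_expansion fps_complex_of_real (F oo G)"
    unfolding fps_complex_of_real_compose
    by (intro has_fps_expansion_compose has_fps_expansion_complex_of_real(1)[OF F]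
        has_fps_expansion_complex_of_real(1)[OF G(1)]) (simp add: G(2))
  \<comment> \<open>The extension of \<open>f\<close> agrees with \<open>f\<close> only near 0;
    since \<open>g\<close> tends to 0, this applies at the points \<open>g x\<close>.\<close>
  have g0: "filterlim g (nhds 0) (nhds 0)"
    using has_fps_expansion_imp_filterlim_nhds[OF G(1)] G(2) by simp
  show "eventually (\<lambda>x. (?f \<circ> ?g) (of_real x) = of_real (f (g x))) (nhds 0)"
    using has_fps_expansion_complex_of_real(2)[OF G(1)]
      eventually_compose_filterlim[OF has_fps_expansion_complex_of_real(2)[OF F] g0]
    by eventually_elim simp
qed

lemma has_fps_expansion_binomial_real:
  fixes a :: real
  shows "(\<lambda>x. (1 + x) powr a) has_fps_expansion fps_binomial a"
proof (rule has_fps_expansionI)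
  have "eventually (\<lambda>x :: real. x \<in> ball 0 1) (nhds 0)"
    by (intro eventually_nhds_in_open) auto
  thus "eventually (\<lambda>x. (\<lambda>n. fps_nth (fps_binomial a) n * x ^ n) sums (1 + x) powr a) (nhds 0)"
    by eventually_elim (simp add: gen_binomial_real)
qed

text \<open>Write \<open>f\<close> as \<open>1 + (f - 1)\<close>: the constant term of
  \<open>F - 1\<close> is 0, so it may be substituted into the binomial series.\<close>

lemma has_fps_expansion_powr_real:
  fixes f :: "real \<Rightarrow> real"
  assumes "f has_fps_expansion F" "fps_nth F 0 = 1"
  shows "(\<lambda>t. f t powr a) has_fps_expansion (fps_binomial a oo (F - 1))"
proof -
  have "(\<lambda>t. f t - 1) has_fps_expansion F - 1"
    by (intro has_fps_expansion_diff assms has_fps_expansion_1)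
  from has_fps_expansion_compose_real[OF has_fps_expansion_binomial_real this, of a] assms(2)
  show ?thesis by simp
qed

section \<open>Falling factorials\<close>

text \<open>Both \<open>pochhammer x n\<close> and \<open>deg_falling lam x n\<close> are products
  of this form, so this yields the vanishing of Lah and degenerate Stirling numbers above the
  diagonal.\<close>

lemma falling_coeff_prod_eq_0:
  assumes "k > n"
  shows "falling_coeff (\<lambda>x. \<Prod>i<n. x + a i) n k = 0"
proof -
  obtain c where c: "\<And>x. (\<Prod>i<n. x + a i) = (\<Sum>k\<le>n. c k * falling x k)" "\<And>k. k > n \<Longrightarrow> c k = 0"
    using prod_falling_expansion[where n = n and a = a] by blast
  have "falling_coeff (\<lambda>x. \<Prod>i<n. x + a i) n = c"
    by (rule falling_coeff_eqI[OF c])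
  with c(2) assms show ?thesis by simp
qed

lemma lah_eq_0: "l > k \<Longrightarrow> lah k l = 0"
  using falling_coeff_prod_eq_0[of k l real]
  by (simp add: lah_def pochhammer_prod lessThan_atLeast0)

lemma deg_stirling2_eq_0: "j > l \<Longrightarrow> deg_stirling2 lam l j = 0"
  using falling_coeff_prod_eq_0[of l j "\<lambda>i. - (real i * lam)"]
  by (simp add: deg_stirling2_def deg_falling_def)

lemma gbinomial_eq_falling: "x gchoose k = falling x k / fact k"
  by (simp add: gbinomial_prod_rev falling_def lessThan_atLeast0)

lemma falling_divide: "lam \<noteq> 0 \<Longrightarrow> lam ^ l * falling (x / lam) l = deg_falling lam x l"
  by (induction l) (simp_all add: falling_def deg_falling_def field_simps)

text \<open>In the Lah expansion at \<open>x / lam\<close>, a factor \<open>lam ^ l\<close> clears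
  the denominators of \<open>falling (x / lam) l\<close> and \<open>lam ^ (k - l)\<close> remains.
  The common range up to \<open>n\<close> makes the coefficients comparable for different
  \<open>k\<close>.\<close>

lemma pochhammer_divide_eq_sum:
  assumes "lam \<noteq> 0" "k \<le> n"
  shows "lam ^ k * pochhammer (x / lam) k =
    (\<Sum>j\<le>n. (\<Sum>l\<le>n. lam ^ (k - l) * lah k l * deg_stirling2 lam l j) * falling x j)"
proof -
  have "lam ^ k * pochhammer (x / lam) k = (\<Sum>l\<le>k. lam ^ k * (lah k l * falling (x / lam) l))"
    by (simp add: pochhammer_eq_sum_lah sum_distrib_left)
  also have "\<dots> = (\<Sum>l\<le>k. lam ^ (k - l) * lah k l * deg_falling lam x l)"
  proof (rule sum.cong)
    fix l assume "l \<in> {..k}"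
    hence "lam ^ k = lam ^ (k - l) * lam ^ l" by (simp flip: power_add)
    thus "lam ^ k * (lah k l * falling (x / lam) l) = lam ^ (k - l) * lah k l * deg_falling lam x l"
      by (simp add: falling_divide[OF assms(1), symmetric])
  qed simp
  \<comment> \<open>For \<open>l > k\<close> the truncated exponent \<open>k - l\<close> does no
    harm, because \<open>lah k l\<close> is 0.\<close>
  also have "\<dots> = (\<Sum>l\<le>n. lam ^ (k - l) * lah k l * deg_falling lam x l)"
    using assms(2) by (intro sum.mono_neutral_left) (auto simp: lah_eq_0)
  also have "\<dots> = (\<Sum>l\<le>n. \<Sum>j\<le>n. lam ^ (k - l) * lah k l * deg_stirling2 lam l j * falling x j)"
  proof (rule sum.cong)
    fix l assume l: "l \<in> {..n}"
    have "deg_falling lam x l = (\<Sum>j\<le>n. deg_stirling2 lam l j * falling x j)"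
      unfolding deg_falling_eq_sum_deg_stirling2
      using l by (intro sum.mono_neutral_left) (auto simp: deg_stirling2_eq_0)
    thus "lam ^ (k - l) * lah k l * deg_falling lam x l =
        (\<Sum>j\<le>n. lam ^ (k - l) * lah k l * deg_stirling2 lam l j * falling x j)"
      by (simp add: sum_distrib_left mult.assoc)
  qed simp
  also have "\<dots> = (\<Sum>j\<le>n. (\<Sum>l\<le>n. lam ^ (k - l) * lah k l * deg_stirling2 lam l j) * falling x j)"
    by (subst sum.swap) (simp add: sum_distrib_right)
  finally show ?thesis .
qed

section \<open>The two expansions of a power of the moment generating function\<close>

lemma deg_mgf_has_fps_expansion:
  assumes "prob_space M" "deg_mgfs_exist M Y" "lam \<noteq> 0"
  obtains F where "deg_mgf M Y lam has_fps_expansion F" "fps_nth F 0 = 1"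
proof
  interpret prob_space M by fact
  let ?F = "Abs_fps (\<lambda>n. (LINT \<omega>|M. deg_falling lam (Y \<omega>) n) / fact n)"
  obtain r where r: "r > 0" "\<And>t. \<bar>t\<bar> < r \<Longrightarrow>
      (\<lambda>n. (LINT \<omega>|M. deg_falling lam (Y \<omega>) n) * t ^ n / fact n) sums deg_mgf M Y lam t"
    using assms(2,3) unfolding deg_mgfs_exist_def by blast
  show "deg_mgf M Y lam has_fps_expansion ?F"
  proof (rule has_fps_expansionI)
    have "eventually (\<lambda>t. t \<in> ball 0 r) (nhds 0)"
      using r(1) by (intro eventually_nhds_in_open) auto
    thus "eventually (\<lambda>t. (\<lambda>n. fps_nth ?F n * t ^ n) sums deg_mgf M Y lam t) (nhds 0)"
      by eventually_elim (use r(2) in simp)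
  qed
  \<comment> \<open>The empty product is 1 and \<open>M\<close> has total mass 1.\<close>
  show "fps_nth ?F 0 = 1" by (simp add: deg_falling_def prob_space)
qed

text \<open>Both compositions expand \<open>A t powr x\<close>: the first directly, the second
  because \<open>1 - lam * v = A t powr (- lam)\<close> for the degenerate logarithm
  \<open>v\<close>, and raising this to the power \<open>- x / lam\<close> gives back
  \<open>A t powr x\<close>. Uniqueness of expansions identifies the series.\<close>

lemma deg_log_fps:
  fixes A :: "real \<Rightarrow> real"
  assumes A: "A has_fps_expansion F" "fps_nth F 0 = 1" and lam: "lam \<noteq> 0"
  obtains V where "(\<lambda>t. deg_log (- lam) (A t)) has_fps_expansion V"
    and "\<And>x. fps_binomial x oo (F - 1) = fps_binomial (- x / lam) oo (fps_const (- lam) * V)"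
proof
  define V where "V = fps_const (1 / - lam) * ((fps_binomial (- lam) oo (F - 1)) - 1)"
  show V: "(\<lambda>t. deg_log (- lam) (A t)) has_fps_expansion V"
    unfolding V_def deg_log_def
    by (intro has_fps_expansion_cmult_left has_fps_expansion_diff has_fps_expansion_1
        has_fps_expansion_powr_real A)
  have V0: "fps_nth V 0 = 0" by (simp add: V_def)
  have "filterlim A (nhds 1) (nhds 0)"
    using has_fps_expansion_imp_filterlim_nhds[OF A(1)] A(2) by simp
  hence pos: "eventually (\<lambda>t. A t > 0) (nhds 0)"
    by (rule order_tendstoD) simp
  show "fps_binomial x oo (F - 1) = fps_binomial (- x / lam) oo (fps_const (- lam) * V)" for x
  proof (rule has_fps_expansion_unique_real)
    show "(\<lambda>t. A t powr x) has_fps_expansion (fps_binomial x oo (F - 1))"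
      by (rule has_fps_expansion_powr_real[OF A])
    have "(\<lambda>t. (1 + (- lam) * deg_log (- lam) (A t)) powr (- x / lam))
        has_fps_expansion (fps_binomial (- x / lam) oo (fps_const (- lam) * V))"
      by (rule has_fps_expansion_compose_real[OF has_fps_expansion_binomial_real
          has_fps_expansion_cmult_left[OF V]]) (simp add: V0)
    moreover have "eventually
        (\<lambda>t. (1 + (- lam) * deg_log (- lam) (A t)) powr (- x / lam) = A t powr x) (nhds 0)"
      using pos
    proof eventually_elim
      case (elim t)
      have "1 + (- lam) * deg_log (- lam) (A t) = A t powr (- lam)"
        using lam by (simp add: deg_log_def)
      thus ?case using lam by (simp only: powr_powr) simp
    qed
    ultimately show "(\<lambda>t. A t powr x) has_fps_expansion
        (fps_binomial (- x / lam) oo (fps_const (- lam) * V))"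
      by (rule iffD1[OF has_fps_expansion_cong[OF _ refl], rotated])
  qed
qed

text \<open>Each side is \<open>fact n\<close> times the coefficient at \<open>n\<close> of one of
  the two expansions; in a composition only the powers up to \<open>n\<close> contribute to
  it.\<close>

lemma sum_prob_deg_stirling2_falling:
  assumes "prob_space M" "deg_mgfs_exist M Y" "lam \<noteq> 0"
  shows "(\<Sum>j\<le>n. prob_deg_stirling2 M Y lam n j * falling x j) =
    (\<Sum>k\<le>n. (- 1) ^ (n - k) * prob_deg_stirling1 M Y lam n k * (lam ^ k * pochhammer (x / lam) k))"
proof -
  obtain F where F: "deg_mgf M Y lam has_fps_expansion F" "fps_nth F 0 = 1"
    using deg_mgf_has_fps_expansion[OF assms] .
  obtain V where V: "(\<lambda>t. deg_log (- lam) (deg_mgf M Y lam t)) has_fps_expansion V"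
    and eq: "\<And>x. fps_binomial x oo (F - 1) = fps_binomial (- x / lam) oo (fps_const (- lam) * V)"
    by (rule deg_log_fps[OF F assms(3)]) (rule that)
  have S2: "prob_deg_stirling2 M Y lam n j = fact n * (fps_nth ((F - 1) ^ j) n / fact j)" for j
  proof -
    have "(\<lambda>t. (1 / fact j) * (deg_mgf M Y lam t - 1) ^ j)
        has_fps_expansion fps_const (1 / fact j) * (F - 1) ^ j"
      by (intro has_fps_expansion_cmult_left has_fps_expansion_power has_fps_expansion_diff
          has_fps_expansion_1 F)
    thus ?thesis by (simp add: prob_deg_stirling2_def egf_coeff_eq)
  qed
  have S1: "(- 1) ^ (n - k) * prob_deg_stirling1 M Y lam n k = fact n * (fps_nth (V ^ k) n / fact k)"
    for k
  proof -
    have "(\<lambda>t. (1 / fact k) * deg_log (- lam) (deg_mgf M Y lam t) ^ k)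
        has_fps_expansion fps_const (1 / fact k) * V ^ k"
      by (intro has_fps_expansion_cmult_left has_fps_expansion_power V)
    thus ?thesis
      by (simp add: prob_deg_stirling1_def egf_coeff_eq)
  qed
  have "(\<Sum>j\<le>n. prob_deg_stirling2 M Y lam n j * falling x j) =
      fact n * fps_nth (fps_binomial x oo (F - 1)) n"
    by (simp add: S2 fps_compose_nth gbinomial_eq_falling sum_distrib_left atLeast0AtMost mult_ac)
  also have "\<dots> = (\<Sum>k\<le>n. fact n * (((- x / lam) gchoose k) * ((- lam) ^ k * fps_nth (V ^ k) n)))"
    by (simp add: eq fps_compose_nth sum_distrib_left atLeast0AtMost power_mult_distrib
        fps_const_power del: power_minus_even)
  also have "\<dots> = (\<Sum>k\<le>n. (- 1) ^ (n - k) * prob_deg_stirling1 M Y lam n k *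
      (lam ^ k * pochhammer (x / lam) k))"
  proof (rule sum.cong)
    fix k
    let ?v = "fps_nth (V ^ k) n"
    \<comment> \<open>The binomial coefficient at the negated argument carries a sign
      \<open>(- 1) ^ k\<close>, which cancels that of \<open>(- lam) ^ k\<close>.\<close>
    have "((- x / lam) gchoose k) * (- lam) ^ k = lam ^ k * pochhammer (x / lam) k / fact k"
      by (simp add: gbinomial_pochhammer power_minus[of lam])
    hence "fact n * (((- x / lam) gchoose k) * ((- lam) ^ k * ?v)) =
        fact n * (lam ^ k * pochhammer (x / lam) k / fact k * ?v)"
      by (simp only: flip: mult.assoc)
    thus "fact n * (((- x / lam) gchoose k) * ((- lam) ^ k * ?v)) =
        (- 1) ^ (n - k) * prob_deg_stirling1 M Y lam n k * (lam ^ k * pochhammer (x / lam) k)"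
      unfolding S1 by (simp add: mult_ac)
  qed simp
  finally show ?thesis .
qed

section \<open>Comparison of coefficients in the basis of falling factorials\<close>

theorem theorem2p5:
  fixes M :: "'a measure" and Y :: "'a \<Rightarrow> real" and lam :: real and n j :: nat
  assumes "prob_space M"
    and "Y \<in> borel_measurable M"
    and "deg_mgfs_exist M Y"
    and "lam \<noteq> 0"
    and "j \<le> n"
  shows "prob_deg_stirling2 M Y lam n j =
    (\<Sum>l=j..n. \<Sum>k=l..n.
       lam ^ (k - l) * (- 1) ^ (n - k) * prob_deg_stirling1 M Y lam n k * lah k l
         * deg_stirling2 lam l j)"
proof -
  define s where "s k = (- 1) ^ (n - k) * prob_deg_stirling1 M Y lam n k" for k
  define T where "T k l j = lam ^ (k - l) * lah k l * deg_stirling2 lam l j" for k l j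
  \<comment> \<open>The coefficients do not depend on \<open>x\<close>, so an identity for all real
    \<open>x\<close> allows \<open>falling_coeffs_unique\<close> to equate them.\<close>
  have "(\<Sum>j\<le>n. prob_deg_stirling2 M Y lam n j * falling x j) =
      (\<Sum>j\<le>n. (\<Sum>k\<le>n. \<Sum>l\<le>n. s k * T k l j) * falling x j)" for x
  proof -
    have "(\<Sum>j\<le>n. prob_deg_stirling2 M Y lam n j * falling x j) =
        (\<Sum>k\<le>n. s k * (\<Sum>j\<le>n. (\<Sum>l\<le>n. T k l j) * falling x j))"
      by (simp add: sum_prob_deg_stirling2_falling[OF assms(1,3,4)]
          pochhammer_divide_eq_sum[OF assms(4), of _ n] s_def T_def)
    also have "\<dots> = (\<Sum>k\<le>n. \<Sum>j\<le>n. (\<Sum>l\<le>n. s k * T k l j) * falling x j)"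
      by (simp only: sum_distrib_left mult.assoc[symmetric])
    also have "\<dots> = (\<Sum>j\<le>n. (\<Sum>k\<le>n. \<Sum>l\<le>n. s k * T k l j) * falling x j)"
      by (subst sum.swap) (simp only: sum_distrib_right)
    finally show ?thesis .
  qed
  from falling_coeffs_unique[OF this assms(5)]
  have "prob_deg_stirling2 M Y lam n j = (\<Sum>l\<le>n. \<Sum>k\<le>n. s k * T k l j)"
    by (subst (asm) sum.swap)
  \<comment> \<open>The full square of indices shrinks to the triangle of the claim: terms with
    \<open>l < j\<close> vanish by \<open>deg_stirling2\<close>, those with \<open>k < l\<close> by
    \<open>lah\<close>.\<close>
  also have "\<dots> = (\<Sum>l=j..n. \<Sum>k\<le>n. s k * T k l j)"
    by (intro sum.mono_neutral_right) (auto simp: T_def deg_stirling2_eq_0)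
  also have "\<dots> = (\<Sum>l=j..n. \<Sum>k=l..n. s k * T k l j)"
    by (intro sum.cong refl sum.mono_neutral_right) (auto simp: T_def lah_eq_0)
  finally show ?thesis by (simp add: s_def T_def mult_ac)
qed

end
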